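(* Let $A_k(x)=\sum_{\pi\in\mathfrak{S}_k}x^{\mathrm{des}(\pi)}$, define $\widetilde{A}_0(x)=1$ and $\widetilde{A}_n(x)=1+x\sum_{k=1}^{n}\binom{n}{k}A_k(x)$ for $n\ge 1$, and write $\widetilde{A}_n(x)=\sum_k\widetilde{A}(n,k)x^k$. Then for all $n\ge 0$ and all $k$, $$\widetilde{A}(n,k)=\bigl|\{\pi\in\mathcal{Q}_{n+1}:\ \mathrm{asc}(\pi)=k\}\bigr|.$$
   Context: Permutations of $[m]=\{1,\dots,m\}$ are written as words $\pi(1)\cdots\pi(m)$; $\mathfrak{S}_m$ is the set of all of them. $\mathrm{des}(\pi)$ (resp. $\mathrm{asc}(\pi)$) is the number of indices $i\in[m-1]$ with $\pi(i)>\pi(i+1)$ (resp. $\pi(i)<\pi(i+1)$). $\mathcal{Q}_m$ denotes the set of permutations $\pi$ of $[m]$ such that $\pi(1)<\pi(2)<\cdots<\pi(p)$ where $p=\pi^{-1}(m)$ (i.e. $m$ is the top of the first descent; the identity permutation is included). *)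

theory Defs
  imports "HOL-Computational_Algebra.Polynomial" "HOL-Combinatorics.Permutations"
begin

text \<open>
  A permutation of \<open>[m]\<close> is a function \<open>\<pi>\<close> with \<open>\<pi> permutes {1..m}\<close> (so \<open>\<pi>\<close> is the identity
  outside \<open>{1..m}\<close>), representing the word \<open>\<pi> 1, \<dots>, \<pi> m\<close>. The length \<open>m\<close> of the word is not
  determined by the function \<open>\<pi>\<close>, hence it is an explicit argument below.
\<close>

definition des :: "nat \<Rightarrow> (nat \<Rightarrow> nat) \<Rightarrow> nat" where
  "des m \<pi> = card {i \<in> {1..m - 1}. \<pi> i > \<pi> (i + 1)}"

definition asc :: "nat \<Rightarrow> (nat \<Rightarrow> nat) \<Rightarrow> nat" where
  "asc m \<pi> = card {i \<in> {1..m - 1}. \<pi> i < \<pi> (i + 1)}"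

definition Q_perms :: "nat \<Rightarrow> (nat \<Rightarrow> nat) set" where
  "Q_perms m = {\<pi>. \<pi> permutes {1..m} \<and> strict_mono_on {1..inv \<pi> m} \<pi>}"

definition eulerian_poly :: "nat \<Rightarrow> int poly" where
  "eulerian_poly k = (\<Sum>\<pi> | \<pi> permutes {1..k}. monom 1 (des k \<pi>))"

definition binomial_eulerian_poly :: "nat \<Rightarrow> int poly" where
  "binomial_eulerian_poly n =
     (if n = 0 then 1
      else 1 + monom 1 1 * (\<Sum>k = 1..n. smult (int (n choose k)) (eulerian_poly k)))"

end

theory Submission
  imports Defs "HOL-Combinatorics.Multiset_Permutations"
begin

text \<open>
  An element of \<open>\<Q>\<^sub>n\<^sub>+\<^sub>1\<close> is the increasing word of a set \<open>T \<subseteq> [n]\<close>, followed by \<open>n + 1\<close> and an arbitrary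
  word on \<open>[n] - T\<close>, which contribute \<open>|T|\<close> ascents and the ascents of the last word. So the ascent
  polynomial of \<open>\<Q>\<^sub>n\<^sub>+\<^sub>1\<close> is \<open>\<Sum>\<^sub>m (n choose m) q\<^sup>n\<^sup>-\<^sup>m A\<^sub>m\<close> with \<open>A\<^sub>0 = 1\<close>, and the claim becomes the symmetry
  \<open>\<Sum>\<^sub>m (n choose m) q\<^sup>n\<^sup>-\<^sup>m A\<^sub>m = 1 + q \<Sum>\<^sub>m\<^sub>\<ge>\<^sub>1 (n choose m) A\<^sub>m\<close>.

  For the symmetry, let \<open>D\<^sub>j\<close> and \<open>P\<^sub>j\<close> sum \<open>q\<^bsup>des(v)\<^esup>\<close> and \<open>q\<^bsup>des(v without its first j letters)\<^esup>\<close> over the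
  words \<open>v\<close> on \<open>[n]\<close> whose first \<open>j\<close> letters increase. Then \<open>P\<^sub>j = (n choose j) A\<^sub>n\<^sub>-\<^sub>j\<close>, and the words that
  continue to increase at the next letter give \<open>q P\<^sub>j = D\<^sub>j + (q - 1) D\<^sub>j\<^sub>+\<^sub>1\<close> for \<open>j < n\<close>. Unrolling from
  \<open>D\<^sub>0 = A\<^sub>n\<close> to \<open>D\<^sub>n = 1\<close> yields a recurrence for \<open>A\<^sub>n\<close>, whose binomial convolution with the powers
  of \<open>q\<close> is the symmetry.
\<close>

section \<open>Counting adjacent pairs in words written as lists\<close>

text \<open>The relation is a parameter so that descents (\<open>R\<close> is \<open>(>)\<close>)
  and ascents (\<open>R\<close> is \<open>(<)\<close>) share one theory and word reversal simply
  flips \<open>R\<close>.\<close>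

fun adj :: "('a \<Rightarrow> 'a \<Rightarrow> bool) \<Rightarrow> 'a list \<Rightarrow> nat" where
  "adj R (x # y # w) = (if R x y then 1 else 0) + adj R (y # w)"
| "adj R _ = 0"

lemma adj_append:
  "u \<noteq> [] \<Longrightarrow> w \<noteq> [] \<Longrightarrow>
     adj R (u @ w) = adj R u + adj R w + (if R (last u) (hd w) then 1 else 0)"
proof (induction R u rule: adj.induct)
  case ("2_2" R x)
  then show ?case by (cases w) auto
qed auto

lemma adj_snoc: "u \<noteq> [] \<Longrightarrow> adj R (u @ [x]) = adj R u + (if R (last u) x then 1 else 0)"
  by (simp add: adj_append)

lemma adj_rev: "adj R (rev w) = adj (\<lambda>x y. R y x) w"
proof (induction w)
  case (Cons x w)
  then show ?case
    using adj_snoc[of "rev w" R x] by (cases w) (simp_all add: last_rev)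
qed simp

text \<open>Bridge from the index counts in \<open>des\<close> and \<open>asc\<close> to counts on
  the word of the permutation.\<close>

lemma adj_map_upt:
  "adj R (map \<pi> [1..<Suc m]) = card {i \<in> {1..m - 1}. R (\<pi> i) (\<pi> (i + 1))}"
proof (induction m)
  case (Suc m)
  show ?case
  proof (cases "m = 0")
    case False
    have "{1..Suc m - 1} = insert m {1..m - 1}" using False by auto
    then have "{i \<in> {1..Suc m - 1}. R (\<pi> i) (\<pi> (i + 1))} =
        {i \<in> {1..m - 1}. R (\<pi> i) (\<pi> (i + 1))} \<union> (if R (\<pi> m) (\<pi> (m + 1)) then {m} else {})"
      by auto
    also have "card \<dots> = card {i \<in> {1..m - 1}. R (\<pi> i) (\<pi> (i + 1))}
        + card (if R (\<pi> m) (\<pi> (m + 1)) then {m} else {})"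
      using False by (intro card_Un_disjoint) auto
    finally have "card {i \<in> {1..Suc m - 1}. R (\<pi> i) (\<pi> (i + 1))} =
        adj R (map \<pi> [1..<Suc m]) + (if R (\<pi> m) (\<pi> (m + 1)) then 1 else 0)"
      using Suc.IH by simp
    moreover have "map \<pi> [1..<Suc (Suc m)] = map \<pi> [1..<Suc m] @ [\<pi> (m + 1)]" by simp
    moreover have "map \<pi> [1..<Suc m] \<noteq> []" "last (map \<pi> [1..<Suc m]) = \<pi> m"
      using False by simp_all
    ultimately show ?thesis using adj_snoc[of "map \<pi> [1..<Suc m]" R "\<pi> (m + 1)"] by simp
  qed simp
qed simp

lemma adj_map_strict_mono:
  fixes h :: "'a::linorder \<Rightarrow> 'b::linorder"
  assumes "strict_mono_on S h" "set w \<subseteq> S"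
  shows "adj (>) (map h w) = adj (>) w"
  using assms(2)
proof (induction "(>) :: 'a \<Rightarrow> 'a \<Rightarrow> bool" w rule: adj.induct)
  case (1 x y w)
  then show ?case using strict_mono_on_less[OF assms(1)] by auto
qed auto

lemma adj_greater_sorted_wrt: "sorted_wrt (<) (u :: 'a::linorder list) \<Longrightarrow> adj (>) u = 0"
  by (induction "(>) :: 'a \<Rightarrow> 'a \<Rightarrow> bool" u rule: adj.induct) auto

lemma sorted_wrt_less_snoc:
  "sorted_wrt (<) (u @ [x]) \<longleftrightarrow>
     sorted_wrt (<) u \<and> (u = [] \<or> last u < (x :: 'a::linorder))"
proof (induction u)
  case (Cons a u)
  then show ?case by (cases u) auto
qed simp

text \<open>An increasing prefix has no descent of its own, so deleting it can only lose the descent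
  at the cut. As letters are distinct, that descent is there exactly when the next letter does not
  prolong the increase; for \<open>j = 0\<close> there is no cut and one letter is always
  sorted.\<close>

lemma adj_greater_prefix:
  fixes v :: "'a::linorder list"
  assumes "distinct v" "j < length v" "sorted_wrt (<) (take j v)"
  shows "adj (>) v = adj (>) (drop j v) + (if sorted_wrt (<) (take (Suc j) v) then 0 else 1)"
proof (cases "j = 0")
  case True
  then show ?thesis using assms by (simp add: take_Suc_conv_app_nth)
next
  case False
  let ?u = "take j v"
  have ne: "?u \<noteq> []" "drop j v \<noteq> []" using False assms(2) by auto
  have hd: "hd (drop j v) = v ! j" using assms(2) by (simp add: hd_drop_conv_nth)
  have "last ?u \<noteq> v ! j"
    using False assms(1,2) last_conv_nth[OF ne(1)] by (simp add: nth_eq_iff_index_eq)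
  moreover have "take (Suc j) v = ?u @ [v ! j]"
    using assms(2) by (simp add: take_Suc_conv_app_nth)
  ultimately have "sorted_wrt (<) (take (Suc j) v) \<longleftrightarrow> \<not> last ?u > v ! j"
    using sorted_wrt_less_snoc[of ?u "v ! j"] assms(3) ne by auto
  then show ?thesis
    using adj_append[OF ne, of "(>)"] adj_greater_sorted_wrt[OF assms(3)] hd by simp
qed

section \<open>Descent enumerators of the words on a set\<close>

text \<open>The Eulerian polynomial at \<open>q\<close>, for words on any alphabet \<open>S\<close>,
  since complements of subsets of [n] occur below. The empty alphabet has one word and gives A_0 =
  1.\<close>

definition descent_sum :: "'b::comm_ring_1 \<Rightarrow> 'a::linorder set \<Rightarrow> 'b" where
  "descent_sum q S = (\<Sum>w\<in>permutations_of_set S. q ^ adj (>) w)"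

text \<open>Reversing a word exchanges ascents and descents.\<close>

lemma descent_sum_ascents:
  "descent_sum q S = (\<Sum>w\<in>permutations_of_set S. q ^ adj (<) w)"
  unfolding descent_sum_def
  by (rule sum.reindex_bij_witness[of _ rev rev])
     (auto simp: permutations_of_set_def adj_rev)

lemma bij_betw_map_permutations_of_set:
  assumes "bij_betw h S T"
  shows "bij_betw (map h) (permutations_of_set S) (permutations_of_set T)"
proof (rule bij_betw_byWitness[where f' = "map (inv_into S h)"])
  have inj: "inj_on h S" and im: "h ` S = T" using assms by (auto simp: bij_betw_def)
  show "\<forall>w\<in>permutations_of_set S. map (inv_into S h) (map h w) = w"
    using inj by (auto simp: permutations_of_set_def intro!: map_idI)
  show "\<forall>w\<in>permutations_of_set T. map h (map (inv_into S h) w) = w"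
    using im by (auto simp: permutations_of_set_def f_inv_into_f intro!: map_idI)
  show "map h ` permutations_of_set S \<subseteq> permutations_of_set T"
    using inj im by (auto simp: permutations_of_set_def distinct_map)
  show "map (inv_into S h) ` permutations_of_set T \<subseteq> permutations_of_set S"
    using bij_betw_inv_into[OF assms]
    by (auto simp: permutations_of_set_def distinct_map bij_betw_def)
qed

lemma descent_sum_strict_mono:
  assumes "strict_mono_on S h"
  shows "descent_sum q (h ` S) = descent_sum q S"
proof -
  have "bij_betw h S (h ` S)"
    using assms by (simp add: bij_betw_def strict_mono_on_imp_inj_on)
  from bij_betw_map_permutations_of_set[OF this] show ?thesis
    unfolding descent_sum_def
    by (rule sum.reindex_bij_betw[symmetric, THEN trans])
       (auto simp: permutations_of_set_def adj_map_strict_mono[OF assms])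
qed

text \<open>Only the relative order of letters matters: \<open>?h i\<close> is the i-th smallest
  element of \<open>S\<close>, with list positions counted from 0, and it relabels {1..card S}
  monotonically.\<close>

lemma descent_sum_card:
  fixes S :: "nat set"
  assumes "finite S"
  shows "descent_sum q S = descent_sum q {1..card S}"
proof -
  let ?s = "sorted_list_of_set S"
  let ?h = "\<lambda>i. ?s ! (i - 1)"
  have "strict_mono_on {1..card S} ?h"
    using assms
    by (auto intro!: strict_mono_onI sorted_wrt_nth_less[OF strict_sorted_list_of_set])
  moreover have "?h ` {1..card S} = S"
  proof -
    have "?h ` {1..card S} = (\<lambda>i. ?s ! i) ` ((\<lambda>i. i - 1) ` {1..card S})"
      by (simp add: image_image)
    also have "(\<lambda>i. i - 1) ` {1..card S} = {..<card S}"
      by (auto simp: image_iff intro!: bexI[of _ "Suc _"])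
    also have "(\<lambda>i. ?s ! i) ` {..<card S} = set ?s"
      using assms by (auto simp: set_conv_nth)
    finally show ?thesis using assms by simp
  qed
  ultimately show ?thesis using descent_sum_strict_mono by metis
qed

section \<open>Permutations of [m] as words\<close>

lemma bij_betw_permutes_words:
  "bij_betw (\<lambda>\<pi>. map \<pi> [1..<Suc m]) {\<pi>. \<pi> permutes {1..m}} (permutations_of_set {1..m})"
proof -
  let ?f = "\<lambda>\<pi>::nat \<Rightarrow> nat. map \<pi> [1..<Suc m]"
  let ?P = "{\<pi>. \<pi> permutes {1..m}}"
  have inj: "inj_on ?f ?P"
  proof (rule inj_onI, rule ext)
    fix \<pi> \<sigma> i assume "\<pi> \<in> ?P" "\<sigma> \<in> ?P" "?f \<pi> = ?f \<sigma>"
    then show "\<pi> i = \<sigma> i"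
      by (cases "i \<in> {1..m}") (auto simp: permutes_not_in simp del: upt_Suc)
  qed
  have "?f ` ?P \<subseteq> permutations_of_set {1..m}"
  proof
    fix v assume "v \<in> ?f ` ?P"
    then obtain \<pi> where \<pi>: "\<pi> permutes {1..m}" "v = ?f \<pi>" by blast
    have "set [1..<Suc m] = {1..m}" by auto
    then show "v \<in> permutations_of_set {1..m}"
      using permutes_image[OF \<pi>(1)] permutes_inj_on[OF \<pi>(1)]
      by (simp add: \<pi>(2) permutations_of_set_def distinct_map del: upt_Suc)
  qed
  \<comment> \<open>Surjectivity by counting: both sets have m! elements.\<close>
  moreover have "card (?f ` ?P) = card (permutations_of_set {1..m})"
    using card_image[OF inj] card_permutations[of "{1..m}" m] by simp
  ultimately have "?f ` ?P = permutations_of_set {1..m}"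
    by (intro card_subset_eq) auto
  with inj show ?thesis by (simp add: bij_betw_def)
qed

lemma eulerian_poly_descent_sum: "eulerian_poly k = descent_sum (monom 1 1) {1..k}"
proof -
  have "descent_sum (monom 1 1) {1..k} =
      (\<Sum>\<pi> | \<pi> permutes {1..k}. (monom 1 1 :: int poly) ^ adj (>) (map \<pi> [1..<Suc k]))"
    unfolding descent_sum_def by (rule sum.reindex_bij_betw[OF bij_betw_permutes_words, symmetric])
  then show ?thesis
    unfolding eulerian_poly_def des_def adj_map_upt by (simp add: monom_power)
qed

section \<open>Words with an increasing prefix and the recurrence\<close>

text \<open>Such a word amounts to the set \<open>T\<close> of its first \<open>j\<close> letters,
  whose order is forced, together with an arbitrary word on the other letters.\<close>

lemma sum_increasing_prefix:
  fixes S :: "'a::linorder set"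
  assumes "finite S" "j \<le> card S"
  shows "(\<Sum>v | v \<in> permutations_of_set S \<and> sorted_wrt (<) (take j v). f (drop j v)) =
    (\<Sum>T | T \<subseteq> S \<and> card T = j. \<Sum>w\<in>permutations_of_set (S - T). f w)"
  (is "sum _ ?V = _")
proof -
  have "(\<Sum>T | T \<subseteq> S \<and> card T = j. \<Sum>w\<in>permutations_of_set (S - T). f w) =
      (\<Sum>(T, w)\<in>Sigma {T. T \<subseteq> S \<and> card T = j} (\<lambda>T. permutations_of_set (S - T)). f w)"
    using assms by (intro sum.Sigma) auto
  also have "\<dots> = (\<Sum>v\<in>?V. f (drop j v))"
  proof (rule sum.reindex_bij_witness[where
        i = "\<lambda>v. (set (take j v), drop j v)" and j = "\<lambda>(T, w). sorted_list_of_set T @ w"])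
    fix a assume "a \<in> Sigma {T. T \<subseteq> S \<and> card T = j} (\<lambda>T. permutations_of_set (S - T))"
    then obtain T w where a: "a = (T, w)" "T \<subseteq> S" "card T = j" "set w = S - T" "distinct w"
      by (auto simp: permutations_of_set_def)
    have fin: "finite T" using a(2) assms(1) by (rule finite_subset)
    show "(set (take j (case a of (T, w) \<Rightarrow> sorted_list_of_set T @ w)),
        drop j (case a of (T, w) \<Rightarrow> sorted_list_of_set T @ w)) = a"
      using a fin by simp
    show "(case a of (T, w) \<Rightarrow> sorted_list_of_set T @ w) \<in> ?V"
      using a fin by (auto simp: permutations_of_set_def)
    show "f (drop j (case a of (T, w) \<Rightarrow> sorted_list_of_set T @ w)) = (case a of (T, w) \<Rightarrow> f w)"
      using a fin by simp
  next
    fix v assume "v \<in> ?V"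
    then have v: "set v = S" "distinct v" "sorted_wrt (<) (take j v)"
      by (auto simp: permutations_of_set_def)
    have "sorted_list_of_set (set (take j v)) = take j v"
      using v by (simp add: sorted_list_of_set.idem_if_sorted_distinct strict_sorted_iff)
    then show "(case (set (take j v), drop j v) of (T, w) \<Rightarrow> sorted_list_of_set T @ w) = v"
      by simp
    have "set (take j v) \<union> set (drop j v) = S" "set (take j v) \<inter> set (drop j v) = {}"
      using v by (metis append_take_drop_id set_append, metis append_take_drop_id distinct_append)
    moreover have "card (set (take j v)) = j"
      using v assms(2) distinct_card[of v] distinct_card[of "take j v"] by simp
    ultimately show "(set (take j v), drop j v)
        \<in> Sigma {T. T \<subseteq> S \<and> card T = j} (\<lambda>T. permutations_of_set (S - T))"
      using v by (auto simp: permutations_of_set_def)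
  qed
  finally show ?thesis by simp
qed

lemma sum_increasing_prefix_descents:
  assumes "j \<le> n"
  shows "(\<Sum>v | v \<in> permutations_of_set {1..n} \<and> sorted_wrt (<) (take j v).
      q ^ adj (>) (drop j v)) =
    of_nat (n choose j) * descent_sum q {1..n - j}"
proof -
  have "(\<Sum>v | v \<in> permutations_of_set {1..n} \<and> sorted_wrt (<) (take j v).
        q ^ adj (>) (drop j v)) =
      (\<Sum>T | T \<subseteq> {1..n} \<and> card T = j. descent_sum q ({1..n} - T))"
    unfolding descent_sum_def using assms by (intro sum_increasing_prefix) auto
  also have "\<dots> = (\<Sum>T | T \<subseteq> {1..n} \<and> card T = j. descent_sum q {1..n - j})"
  proof (rule sum.cong)
    fix T assume "T \<in> {T. T \<subseteq> {1..n} \<and> card T = j}"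
    then have "card ({1..n} - T) = n - j"
      by (subst card_Diff_subset) (auto intro: finite_subset)
    then show "descent_sum q ({1..n} - T) = descent_sum q {1..n - j}"
      using descent_sum_card[of "{1..n} - T" q] by simp
  qed simp
  also have "\<dots> = of_nat (n choose j) * descent_sum q {1..n - j}"
    using n_subsets[of "{1..n}" j] by simp
  finally show ?thesis .
qed

text \<open>Found by eliminating the sums \<open>D j\<close> between \<open>D 0\<close> and
  \<open>D n\<close>. The term \<open>i = n\<close> on the right contains
  \<open>descent_sum q {1..n}\<close> itself, so this is a linear relation and not a direct
  recursion.\<close>

lemma descent_sum_recurrence:
  "descent_sum q {1..n} =
    q * (\<Sum>i\<le>n. of_nat (n choose i) * (1 - q) ^ (n - i) * descent_sum q {1..i}) + (1 - q) ^ (n + 1)"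
proof -
  define V where "V j = {v \<in> permutations_of_set {1..n}. sorted_wrt (<) (take j v)}" for j
  define D where "D j = (\<Sum>v\<in>V j. q ^ adj (>) v)" for j
  define P where "P j = of_nat (n choose j) * descent_sum q {1..n - j}" for j
  have len: "length v = n" if "v \<in> permutations_of_set {1..n}" for v
    using that distinct_card[of v] by (auto simp: permutations_of_set_def)
  have finV: "finite (V j)" for j by (simp add: V_def)
  \<comment> \<open>Compare \<open>q * q ^ adj (>) (drop j v)\<close> with
    \<open>q ^ adj (>) v\<close>: they agree if the letter after the prefix breaks the increase;
    otherwise the former is \<open>q\<close> times the latter, and the surplus \<open>q - 1\<close>
    is collected over \<open>V (Suc j)\<close>.\<close>
  have step: "q * P j = D j + (q - 1) * D (Suc j)" if "j < n" for j
  proof -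
    have V_Suc: "V (Suc j) = {v \<in> V j. sorted_wrt (<) (take (Suc j) v)}"
    proof -
      have "sorted_wrt (<) (take j v)" if "sorted_wrt (<) (take (Suc j) v)" for v :: "nat list"
        using sorted_wrt_take[OF that, of j] by (simp add: min_def)
      then show ?thesis by (auto simp: V_def)
    qed
    have "q * P j = (\<Sum>v\<in>V j. q * q ^ adj (>) (drop j v))"
      using sum_increasing_prefix_descents[of j n q] that by (simp add: P_def V_def sum_distrib_left[symmetric])
    also have "\<dots> = (\<Sum>v\<in>V j. q ^ adj (>) v +
        (if sorted_wrt (<) (take (Suc j) v) then (q - 1) * q ^ adj (>) v else 0))"
    proof (rule sum.cong)
      fix v assume "v \<in> V j"
      then have "distinct v" "j < length v" "sorted_wrt (<) (take j v)"
        using len that by (auto simp: V_def permutations_of_set_def)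
      from adj_greater_prefix[OF this]
      show "q * q ^ adj (>) (drop j v) = q ^ adj (>) v +
          (if sorted_wrt (<) (take (Suc j) v) then (q - 1) * q ^ adj (>) v else 0)"
        by (simp add: algebra_simps)
    qed simp
    also have "\<dots> = D j + (q - 1) * D (Suc j)"
      using finV by (simp add: sum.distrib D_def V_Suc sum_distrib_left flip: sum.inter_filter)
    finally show ?thesis .
  qed
  \<comment> \<open>Iterates \<open>step\<close> in the form
    \<open>D m = q * P m + (1 - q) * D (Suc m)\<close>.\<close>
  have unroll: "D 0 = q * (\<Sum>i<m. (1 - q) ^ i * P i) + (1 - q) ^ m * D m" if "m \<le> n" for m
    using that
  proof (induction m)
    case (Suc m)
    have "D m = q * P m + (1 - q) * D (Suc m)"
      using step[of m] Suc.prems by (simp add: algebra_simps)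
    then have "(1 - q) ^ m * D m = (1 - q) ^ m * (q * P m) + (1 - q) ^ Suc m * D (Suc m)"
      by (simp only: distrib_left power_Suc2 mult.assoc)
    then show ?case using Suc by (simp add: distrib_left mult.left_commute)
  qed simp
  \<comment> \<open>Only the increasing word has all \<open>n\<close> letters in increasing
    order.\<close>
  have "V n = {sorted_list_of_set {1..n}}"
  proof -
    have "v = sorted_list_of_set {1..n}" if "v \<in> V n" for v
      using that len by (auto simp: V_def permutations_of_set_def strict_sorted_iff
          sorted_list_of_set.idem_if_sorted_distinct dest: sym)
    moreover have "sorted_list_of_set {1..n} \<in> V n"
      by (auto simp: V_def permutations_of_set_def)
    ultimately show ?thesis by blast
  qed
  then have Dn: "D n = 1"
    by (simp add: D_def adj_greater_sorted_wrt)
  have "P n = 1" by (simp add: P_def descent_sum_def)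
  have "descent_sum q {1..n} = D 0" by (simp add: D_def V_def descent_sum_def)
  also have "\<dots> = q * (\<Sum>i<n. (1 - q) ^ i * P i) + (1 - q) ^ n" using unroll[of n] Dn by simp
  \<comment> \<open>The missing term \<open>i = n\<close> is added by splitting
    \<open>(1 - q) ^ n\<close> as \<open>q * (1 - q) ^ n + (1 - q) ^ (n + 1)\<close>.\<close>
  also have "\<dots> = q * (\<Sum>i\<le>n. (1 - q) ^ i * P i) + (1 - q) ^ (n + 1)"
    using \<open>P n = 1\<close> by (simp add: lessThan_Suc_atMost[symmetric] algebra_simps)
  also have "(\<Sum>i\<le>n. (1 - q) ^ i * P i) =
      (\<Sum>i\<le>n. of_nat (n choose i) * (1 - q) ^ (n - i) * descent_sum q {1..i})"
    by (rule sum.reindex_bij_witness[of _ "\<lambda>i. n - i" "\<lambda>i. n - i"])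
       (auto simp: P_def binomial_symmetric[symmetric] algebra_simps)
  finally show ?thesis .
qed

section \<open>Binomial convolution and the symmetry\<close>

text \<open>In exponential generating functions this is exp(ax) exp(bx) = exp((a+b)x), applied to
  the series of \<open>f\<close>. The proof swaps the sums and uses \<open>choose_mult\<close> and
  the binomial theorem.\<close>

lemma binomial_convolution_power:
  fixes a b :: "'a::comm_ring_1"
  shows "(\<Sum>m\<le>n. of_nat (n choose m) * a ^ (n - m) *
      (\<Sum>i\<le>m. of_nat (m choose i) * b ^ (m - i) * f i)) =
    (\<Sum>i\<le>n. of_nat (n choose i) * (a + b) ^ (n - i) * f i)"
proof -
  let ?t = "\<lambda>m i. of_nat (n choose m) * a ^ (n - m) * (of_nat (m choose i) * b ^ (m - i) * f i)"
  have "(\<Sum>m\<le>n. of_nat (n choose m) * a ^ (n - m) *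
      (\<Sum>i\<le>m. of_nat (m choose i) * b ^ (m - i) * f i)) = (\<Sum>m\<le>n. \<Sum>i\<le>n. ?t m i)"
    \<comment> \<open>The inner range grows to \<open>i \<le> n\<close> because
      \<open>m choose i\<close> vanishes for \<open>i > m\<close>; the sums then swap
      freely.\<close>
    unfolding sum_distrib_left
    by (rule sum.cong[OF refl], rule sum.mono_neutral_left)
      (simp_all add: binomial_eq_0 not_le Ball_def)
  also have "\<dots> = (\<Sum>i\<le>n. \<Sum>m\<le>n. ?t m i)" by (rule sum.swap)
  also have "\<dots> = (\<Sum>i\<le>n. of_nat (n choose i) * (a + b) ^ (n - i) * f i)"
  proof (rule sum.cong)
    fix i assume "i \<in> {..n}"
    then have i: "i \<le> n" by simp
    have "(\<Sum>m\<le>n. ?t m i) = (\<Sum>m=i..n. ?t m i)"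
      by (rule sum.mono_neutral_right) (auto simp: binomial_eq_0)
    also have "\<dots> = (\<Sum>l\<le>n - i. of_nat (n choose i) * f i *
        (of_nat (n - i choose l) * b ^ l * a ^ (n - i - l)))"
    proof (rule sum.reindex_bij_witness[of _ "\<lambda>l. l + i" "\<lambda>m. m - i"])
      fix m assume "m \<in> {i..n}"
      then have "of_nat (n choose m) * of_nat (m choose i) =
          (of_nat (n choose i) * of_nat (n - i choose (m - i)) :: 'a)"
        using choose_mult[of i m n] by (metis atLeastAtMost_iff of_nat_mult)
      moreover have "?t m i =
          (of_nat (n choose m) * of_nat (m choose i)) * (f i * b ^ (m - i) * a ^ (n - m))"
        by (simp only: mult_ac)
      moreover have "n - i - (m - i) = n - m" using \<open>m \<in> {i..n}\<close> by auto
      ultimately show "of_nat (n choose i) * f i *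
          (of_nat (n - i choose (m - i)) * b ^ (m - i) * a ^ (n - i - (m - i))) = ?t m i"
        by (simp only: mult_ac)
    qed (use i in auto)
    also have "\<dots> = of_nat (n choose i) * (a + b) ^ (n - i) * f i"
      unfolding add.commute[of a b] binomial_ring[of b a] sum_distrib_left[symmetric]
      by (simp only: mult_ac)
    finally show "(\<Sum>m\<le>n. ?t m i) = of_nat (n choose i) * (a + b) ^ (n - i) * f i" .
  qed simp
  finally show ?thesis .
qed

text \<open>Inserting the recurrence convolves powers of \<open>1 - q\<close> with powers of
  \<open>q\<close>. Since these add up to 1, all powers disappear and
  \<open>q * (1 + S) + (1 - q) = 1 + q * S\<close> remains, where S is the sum over
  \<open>i \<ge> 1\<close>.\<close>

lemma descent_sum_binomial_identity:
  "(\<Sum>m\<le>n. of_nat (n choose m) * q ^ (n - m) * descent_sum q {1..m}) =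
    1 + q * (\<Sum>i=1..n. of_nat (n choose i) * descent_sum q {1..i})"
proof -
  let ?E = "\<lambda>m. descent_sum q {1..m}"
  let ?R = "\<lambda>m. \<Sum>i\<le>m. of_nat (m choose i) * (1 - q) ^ (m - i) * ?E i"
  have "(\<Sum>m\<le>n. of_nat (n choose m) * q ^ (n - m) * ?E m) =
      (\<Sum>m\<le>n. of_nat (n choose m) * q ^ (n - m) * (q * ?R m + (1 - q) ^ (m + 1)))"
    by (subst descent_sum_recurrence) simp
  also have "\<dots> = q * (\<Sum>m\<le>n. of_nat (n choose m) * q ^ (n - m) * ?R m) +
      (1 - q) * (\<Sum>m\<le>n. of_nat (n choose m) * (1 - q) ^ m * q ^ (n - m))"
  proof -
    \<comment> \<open>Proved for an arbitrary \<open>R\<close>, so that simplification cannot break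
      up the inner sum \<open>?R\<close>.\<close>
    have "(\<Sum>m\<le>n. of_nat (n choose m) * q ^ (n - m) * (q * R m + (1 - q) ^ (m + 1))) =
        q * (\<Sum>m\<le>n. of_nat (n choose m) * q ^ (n - m) * R m) +
        (1 - q) * (\<Sum>m\<le>n. of_nat (n choose m) * (1 - q) ^ m * q ^ (n - m))" for R
      unfolding sum_distrib_left sum.distrib[symmetric]
      by (rule sum.cong) (simp_all add: algebra_simps)
    then show ?thesis .
  qed
  also have "(\<Sum>m\<le>n. of_nat (n choose m) * (1 - q) ^ m * q ^ (n - m)) = 1"
    using binomial_ring[of "1 - q" q n] by simp
  also have "(\<Sum>m\<le>n. of_nat (n choose m) * q ^ (n - m) * ?R m) =
      (\<Sum>i\<le>n. of_nat (n choose i) * ?E i)"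
    by (simp add: binomial_convolution_power)
  also have "\<dots> = 1 + (\<Sum>i=1..n. of_nat (n choose i) * ?E i)"
    by (simp add: atMost_atLeast0 sum.atLeast_Suc_atMost[of 0] descent_sum_def)
  finally show ?thesis by (simp add: algebra_simps)
qed

section \<open>Ascents of the words of \<open>Q_perms\<close>\<close>

text \<open>Each letter of \<open>u\<close> starts an ascent, and the maximal \<open>x\<close>
  starts none.\<close>

lemma adj_less_increasing_append_Max:
  fixes x :: "'a::linorder"
  assumes "sorted_wrt (<) (u @ [x])" "\<forall>y\<in>set w. y < x"
  shows "adj (<) (u @ x # w) = length u + adj (<) w"
  using assms(1)
proof (induction u)
  case Nil
  then show ?case using assms(2) by (cases w) auto
next
  case (Cons a u)
  then show ?case by (cases u) auto
qed

lemma takeWhile_dropWhile_neq: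
  assumes "x \<notin> set u"
  shows "takeWhile (\<lambda>y. y \<noteq> x) (u @ x # w) = u" "dropWhile (\<lambda>y. y \<noteq> x) (u @ x # w) = x # w"
  using assms by (induction u) auto

lemma Q_perms_iff_word:
  assumes "\<pi> permutes {1..m}" "0 < m"
  shows "\<pi> \<in> Q_perms m \<longleftrightarrow> (\<exists>u w. map \<pi> [1..<Suc m] = u @ m # w \<and> sorted_wrt (<) (u @ [m]))"
proof -
  let ?p = "inv \<pi> m"
  have p\<pi>: "\<pi> ?p = m" using assms(1) by (simp add: permutes_inverses)
  have p: "1 \<le> ?p" "?p \<le> m"
    using permutes_in_image[OF permutes_inv[OF assms(1)], of m] assms(2) by auto
  have split: "[1..<Suc m] = [1..<?p] @ ?p # [Suc ?p..<Suc m]"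
    using p upt_add_eq_append[of 1 ?p "Suc m - ?p"] upt_conv_Cons[of ?p "Suc m"]
    by (simp del: upt_Suc)
  have mono: "strict_mono_on {1..?p} \<pi> \<longleftrightarrow> sorted_wrt (<) (map \<pi> [1..<?p] @ [m])"
  proof -
    have "map \<pi> [1..<?p] @ [m] = map \<pi> [1..<Suc ?p]" using p p\<pi> by simp
    moreover have "sorted_wrt (<) (map \<pi> [1..<Suc ?p]) \<longleftrightarrow> strict_mono_on {1..?p} \<pi>"
    proof
      assume s: "sorted_wrt (<) (map \<pi> [1..<Suc ?p])"
      show "strict_mono_on {1..?p} \<pi>"
      proof (rule strict_mono_onI)
        fix r s assume "r \<in> {1..?p}" "s \<in> {1..?p}" "r < s"
        then show "\<pi> r < \<pi> s"
          using sorted_wrt_nth_less[OF s, of "r - 1" "s - 1"] by (simp del: upt_Suc)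
      qed
    next
      assume s: "strict_mono_on {1..?p} \<pi>"
      show "sorted_wrt (<) (map \<pi> [1..<Suc ?p])"
        unfolding sorted_wrt_iff_nth_less
        using strict_mono_onD[OF s] by (simp del: upt_Suc)
    qed
    ultimately show ?thesis by simp
  qed
  have word: "map \<pi> [1..<Suc m] = map \<pi> [1..<?p] @ m # map \<pi> [Suc ?p..<Suc m]"
    unfolding split by (simp add: p\<pi> del: upt_Suc)
  \<comment> \<open>The letter \<open>m\<close> occurs only once, so any witness pair
    \<open>u\<close>, \<open>w\<close> is the split at position \<open>?p\<close>.\<close>
  have "u = map \<pi> [1..<?p]" if "map \<pi> [1..<Suc m] = u @ m # w" for u w
  proof -
    have "distinct (map \<pi> [1..<Suc m])"
      using permutes_inj_on[OF assms(1)] by (simp add: distinct_map del: upt_Suc)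
    then have "m \<notin> set u" "m \<notin> set (map \<pi> [1..<?p])"
      using that word by (metis distinct_append disjoint_iff list.set_intros(1))+
    then show ?thesis using that word by (metis takeWhile_dropWhile_neq(1))
  qed
  then show ?thesis
    unfolding Q_perms_def using assms(1) mono word by blast
qed

text \<open>\<open>T\<close> is the set of letters before \<open>n + 1\<close>; the word
  \<open>w\<close> after it is free. The ascents number \<open>card T + adj (<) w\<close>, and
  reversal turns the sum over \<open>w\<close> into a descent sum.\<close>

lemma sum_Q_perms_ascents:
  fixes q :: "'a::comm_ring_1"
  shows "(\<Sum>\<pi>\<in>Q_perms (n + 1). q ^ asc (n + 1) \<pi>) =
    (\<Sum>T\<in>Pow {1..n}. q ^ card T * descent_sum q ({1..n} - T))"
proof -
  let ?W = "{v \<in> permutations_of_set {1..Suc n}.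
    \<exists>u w. v = u @ Suc n # w \<and> sorted_wrt (<) (u @ [Suc n])}"
  let ?f = "\<lambda>\<pi>::nat \<Rightarrow> nat. map \<pi> [1..<Suc (Suc n)]"
  have bij: "bij_betw ?f (Q_perms (Suc n)) ?W"
  proof -
    let ?A = "{\<pi>. \<pi> permutes {1..Suc n}}"
    have im: "?f ` ?A = permutations_of_set {1..Suc n}" and inj: "inj_on ?f ?A"
      using bij_betw_permutes_words[of "Suc n"] by (auto simp only: bij_betw_def)
    have Q: "Q_perms (Suc n) =
        {\<pi> \<in> ?A. \<exists>u w. ?f \<pi> = u @ Suc n # w \<and> sorted_wrt (<) (u @ [Suc n])}"
    proof -
      have "Q_perms (Suc n) \<subseteq> ?A" by (auto simp: Q_perms_def)
      then show ?thesis using Q_perms_iff_word[of _ "Suc n"] by blast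
    qed
    have "?f ` Q_perms (Suc n) = ?W" unfolding Q im[symmetric] by blast
    moreover have "inj_on ?f (Q_perms (Suc n))" by (rule inj_on_subset[OF inj]) (use Q in blast)
    ultimately show ?thesis unfolding bij_betw_def by blast
  qed
  have "(\<Sum>T\<in>Pow {1..n}. q ^ card T * descent_sum q ({1..n} - T)) =
      (\<Sum>T\<in>Pow {1..n}. \<Sum>w\<in>permutations_of_set ({1..n} - T). q ^ (card T + adj (<) w))"
    by (simp add: descent_sum_ascents sum_distrib_left power_add)
  also have "\<dots> = (\<Sum>(T, w)\<in>Sigma (Pow {1..n}) (\<lambda>T. permutations_of_set ({1..n} - T)).
      q ^ (card T + adj (<) w))"
    by (intro sum.Sigma) auto
  also have "\<dots> = (\<Sum>v\<in>?W. q ^ adj (<) v)"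
  \<comment> \<open>The inverse map cuts the word at the letter \<open>Suc n\<close>;
    \<open>tl\<close> removes that letter itself.\<close>
  proof (rule sum.reindex_bij_witness[where
        i = "\<lambda>v. (set (takeWhile (\<lambda>x. x \<noteq> Suc n) v), tl (dropWhile (\<lambda>x. x \<noteq> Suc n) v))" and
        j = "\<lambda>(T, w). sorted_list_of_set T @ Suc n # w"])
    fix a assume "a \<in> Sigma (Pow {1..n}) (\<lambda>T. permutations_of_set ({1..n} - T))"
    then obtain T w where a: "a = (T, w)" "T \<subseteq> {1..n}" "set w = {1..n} - T" "distinct w"
      by (auto simp: permutations_of_set_def)
    let ?u = "sorted_list_of_set T"
    have u: "finite T" "set ?u = T" using finite_subset[OF a(2)] by auto
    have sn: "x \<noteq> Suc n" "x < Suc n" if "x \<in> T" for x using a(2) that by auto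
    have sorted: "sorted_wrt (<) (?u @ [Suc n])"
      using u sn by (auto simp: sorted_wrt_append)
    have "takeWhile (\<lambda>x. x \<noteq> Suc n) (?u @ Suc n # w) = ?u"
        "dropWhile (\<lambda>x. x \<noteq> Suc n) (?u @ Suc n # w) = Suc n # w"
      using takeWhile_dropWhile_neq[of "Suc n" ?u w] u sn(1) by auto
    then show "(set (takeWhile (\<lambda>x. x \<noteq> Suc n) (case a of (T, w) \<Rightarrow> sorted_list_of_set T @ Suc n # w)),
        tl (dropWhile (\<lambda>x. x \<noteq> Suc n) (case a of (T, w) \<Rightarrow> sorted_list_of_set T @ Suc n # w))) = a"
      using a u by simp
    have "?u @ Suc n # w \<in> permutations_of_set {1..Suc n}"
      using a u sn by (auto simp: permutations_of_set_def)
    then show "(case a of (T, w) \<Rightarrow> sorted_list_of_set T @ Suc n # w) \<in> ?W"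
      using a(1) sorted by auto
    have "\<forall>y\<in>set w. y < Suc n" using a(3) by auto
    from adj_less_increasing_append_Max[OF sorted this]
    show "q ^ adj (<) (case a of (T, w) \<Rightarrow> sorted_list_of_set T @ Suc n # w) =
        (case a of (T, w) \<Rightarrow> q ^ (card T + adj (<) w))"
      using a(1) by simp
  next
    fix v assume "v \<in> ?W"
    then obtain u w where v: "v = u @ Suc n # w" "sorted_wrt (<) (u @ [Suc n])"
        "set v = {1..Suc n}" "distinct v"
      by (auto simp: permutations_of_set_def)
    have ne: "\<forall>x\<in>set u. x \<noteq> Suc n" using v(1,4) by auto
    then have tw: "takeWhile (\<lambda>x. x \<noteq> Suc n) v = u" "tl (dropWhile (\<lambda>x. x \<noteq> Suc n) v) = w"
      using takeWhile_dropWhile_neq[of "Suc n" u w] by (auto simp: v(1))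
    have "sorted_list_of_set (set u) = u"
      using v(2) by (simp add: sorted_wrt_append strict_sorted_iff
          sorted_list_of_set.idem_if_sorted_distinct)
    then show "(case (set (takeWhile (\<lambda>x. x \<noteq> Suc n) v), tl (dropWhile (\<lambda>x. x \<noteq> Suc n) v)) of
        (T, w) \<Rightarrow> sorted_list_of_set T @ Suc n # w) = v"
      by (simp only: tw prod.case) (simp add: v(1))
    have "{1..n} = {1..Suc n} - {Suc n}" by auto
    also have "\<dots> = set u \<union> set w" using v by auto
    finally have un: "{1..n} = set u \<union> set w" .
    moreover have "set u \<inter> set w = {}" "distinct w" using v(1,4) by auto
    ultimately have "set u \<in> Pow {1..n}" "w \<in> permutations_of_set ({1..n} - set u)"
      by (auto simp only: permutations_of_set_def)
    then show "(set (takeWhile (\<lambda>x. x \<noteq> Suc n) v), tl (dropWhile (\<lambda>x. x \<noteq> Suc n) v))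
        \<in> Sigma (Pow {1..n}) (\<lambda>T. permutations_of_set ({1..n} - T))"
      unfolding tw by blast
  qed
  also have "\<dots> = (\<Sum>\<pi>\<in>Q_perms (Suc n). q ^ adj (<) (?f \<pi>))"
    by (rule sum.reindex_bij_betw[OF bij, symmetric])
  also have "\<dots> = (\<Sum>\<pi>\<in>Q_perms (n + 1). q ^ asc (n + 1) \<pi>)"
    unfolding asc_def adj_map_upt by simp
  finally show ?thesis by simp
qed

section \<open>The polynomial identity and its coefficients\<close>

lemma sum_Pow_card:
  fixes f :: "nat \<Rightarrow> 'b::semiring_1"
  assumes "finite S"
  shows "(\<Sum>T\<in>Pow S. f (card T)) = (\<Sum>j\<le>card S. of_nat (card S choose j) * f j)"
proof -
  have "(\<Sum>T\<in>Pow S. f (card T)) = (\<Sum>j\<le>card S. \<Sum>T | T \<in> Pow S \<and> card T = j. f (card T))"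
    using assms by (intro sum.group[symmetric]) (auto intro: card_mono)
  also have "\<dots> = (\<Sum>j\<le>card S. of_nat (card S choose j) * f j)"
    using assms by (intro sum.cong) (simp_all add: n_subsets)
  finally show ?thesis .
qed

lemma binomial_eulerian_poly_Q_perms:
  "binomial_eulerian_poly n = (\<Sum>\<pi>\<in>Q_perms (n + 1). monom 1 (asc (n + 1) \<pi>))"
proof -
  let ?q = "monom 1 1 :: int poly"
  have "(\<Sum>\<pi>\<in>Q_perms (n + 1). monom 1 (asc (n + 1) \<pi>)) =
      (\<Sum>\<pi>\<in>Q_perms (n + 1). ?q ^ asc (n + 1) \<pi>)"
    by (simp add: monom_power)
  also have "\<dots> = (\<Sum>T\<in>Pow {1..n}. ?q ^ card T * descent_sum ?q ({1..n} - T))"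
    by (rule sum_Q_perms_ascents)
  also have "\<dots> = (\<Sum>T\<in>Pow {1..n}. ?q ^ card T * descent_sum ?q {1..n - card T})"
  proof (rule sum.cong)
    fix T assume "T \<in> Pow {1..n}"
    then have "card ({1..n} - T) = n - card T"
      by (subst card_Diff_subset) (auto intro: finite_subset)
    then show "?q ^ card T * descent_sum ?q ({1..n} - T) = ?q ^ card T * descent_sum ?q {1..n - card T}"
      using descent_sum_card[of "{1..n} - T" ?q] by simp
  qed simp
  also have "\<dots> = (\<Sum>j\<le>n. of_nat (n choose j) * (?q ^ j * descent_sum ?q {1..n - j}))"
    using sum_Pow_card[of "{1..n}" "\<lambda>j. ?q ^ j * descent_sum ?q {1..n - j}"] by simp
  \<comment> \<open>With \<open>m = n - j\<close>, the size of the free part, this becomes the left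
    side of the symmetry.\<close>
  also have "\<dots> = (\<Sum>m\<le>n. of_nat (n choose m) * ?q ^ (n - m) * descent_sum ?q {1..m})"
    by (rule sum.reindex_bij_witness[of _ "\<lambda>i. n - i" "\<lambda>i. n - i"])
       (auto simp: binomial_symmetric[symmetric] algebra_simps)
  also have "\<dots> = 1 + ?q * (\<Sum>i=1..n. of_nat (n choose i) * descent_sum ?q {1..i})"
    by (rule descent_sum_binomial_identity)
  also have "\<dots> = binomial_eulerian_poly n"
    by (simp add: binomial_eulerian_poly_def eulerian_poly_descent_sum of_nat_poly)
  finally show ?thesis by simp
qed

theorem theorem2p7:
  fixes n k :: nat
  shows "coeff (binomial_eulerian_poly n) k = int (card {\<pi> \<in> Q_perms (n + 1). asc (n + 1) \<pi> = k})"
proof -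
  have "finite (Q_perms (n + 1))"
    by (rule finite_subset[OF _ finite_permutations[of "{1..n + 1}"]]) (auto simp: Q_perms_def)
  then show ?thesis
    \<comment> \<open>Each permutation contributes a monomial whose \<open>k\<close>-th coefficient
      is 1 if \<open>asc\<close> equals \<open>k\<close> and 0 otherwise; finiteness lets the sum
      become a cardinality.\<close>
    by (simp add: binomial_eulerian_poly_Q_perms coeff_sum sum.If_cases Int_def)
qed

end
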